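(* Let $X=\{(\Lambda_k,m^{(k)})\}_{k\ge1}$ be an array satisfying $\lim_{k\to\infty}\frac1k\sup_{\lambda\in\Lambda_k}m_\lambda=0$, and suppose $X$ is an $L^2$-sampling array for $\{\mathcal P_k\}$. Then: (a) $X$ has finite overlap, i.e. $S_X:=\sup_{k\ge1}\sup_{z\in\mathbb C}\sum_{\lambda\in\Lambda_k}\chi_{D_{\lambda,m_\lambda}}(z)<\infty$, where $D_{\lambda,m_\lambda}=D(\lambda,\sqrt{m_\lambda/k})$ for $\lambda\in\Lambda_k$; (b) there exist $c>0$ and $k_0\in\mathbb N$ such that for all $k\ge k_0$, $$\bigcup_{\lambda\in\Lambda_k}D\Bigl(\lambda,\frac{\sqrt{m_\lambda}+c}{\sqrt k}\Bigr)=\mathbb C.$$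
   Context: $\mathcal P_k$ is the space of holomorphic polynomials in one complex variable of degree at most $k$. Let $d\nu(z)=\frac{dm(z)}{\pi(1+|z|^2)^2}$ on $\mathbb C$. $\mathcal P_k$ carries the inner product $\langle p,q\rangle_k=(k+1)\int_{\mathbb C}p\,\bar q\,\frac{d\nu}{(1+|z|^2)^k}$ and norm $\|p\|_{k,2}=\langle p,p\rangle_k^{1/2}$; $e_{k,j}(z)=\binom{k}{j}^{1/2}z^j$, $j=0,\dots,k$, is an orthonormal basis. Chordal distance $d(z,w)=\frac{|z-w|}{(1+|z|^2)^{1/2}(1+|w|^2)^{1/2}}$, $D(z,r)=\{w: d(z,w)<r\}$. For $\lambda\in\mathbb C$, $\varphi_\lambda(z)=\frac{\lambda-z}{1+\bar\lambda z}$ and $T_\lambda p(z)=\frac{(1+\bar\lambda z)^k}{(1+|\lambda|^2)^{k/2}}p(\varphi_\lambda(z))$. An array $X=\{(\Lambda_k,m^{(k)})\}_{k\ge1}$ consists of finite sets $\Lambda_k\subset\mathbb C$ with positive integer multiplicities $m_\lambda$, $\lambda\in\Lambda_k$. $X$ is $L^2$-sampling if there is $C>0$ such that for all $k\ge1$ and all $p\in\mathcal P_k$, $\frac1C\|p\|_{k,2}^2\le\sum_{\lambda\in\Lambda_k}\sum_{j=0}^{m_\lambda-1}|\langle p,T_\lambda e_{k,j}\rangle_k|^2\le C\|p\|_{k,2}^2.$ *)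

theory Defs
  imports "HOL-Analysis.Analysis" "HOL-Computational_Algebra.Polynomial"
begin

text \<open>Inner product on P_k:
  (k+1) * integral of p * conj q against dnu/(1+|z|^2)^k, with
  dnu = dm / (pi (1+|z|^2)^2), dm = Lebesgue measure on the plane.\<close>
definition inner_k :: "nat \<Rightarrow> (complex \<Rightarrow> complex) \<Rightarrow> (complex \<Rightarrow> complex) \<Rightarrow> complex" where
  "inner_k k p q = of_nat (k+1) *
     (LINT z|lborel. p z * cnj (q z) / complex_of_real (pi * (1 + (cmod z)^2) ^ (k+2)))"

definition norm2_k :: "nat \<Rightarrow> (complex \<Rightarrow> complex) \<Rightarrow> real" where
  "norm2_k k p = Re (inner_k k p p)"

definition e_k :: "nat \<Rightarrow> nat \<Rightarrow> complex \<Rightarrow> complex" where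
  "e_k k j z = complex_of_real (sqrt (real (k choose j))) * z ^ j"

definition phi :: "complex \<Rightarrow> complex \<Rightarrow> complex" where
  "phi l z = (l - z) / (1 + cnj l * z)"

definition T_k :: "nat \<Rightarrow> complex \<Rightarrow> (complex \<Rightarrow> complex) \<Rightarrow> complex \<Rightarrow> complex" where
  "T_k k l p z = (1 + cnj l * z) ^ k / complex_of_real ((1 + (cmod l)^2) powr (real k / 2)) * p (phi l z)"

definition chordal_dist :: "complex \<Rightarrow> complex \<Rightarrow> real" where
  "chordal_dist z w = cmod (z - w) / (sqrt (1 + (cmod z)^2) * sqrt (1 + (cmod w)^2))"

definition chordal_disc :: "complex \<Rightarrow> real \<Rightarrow> complex set" where
  "chordal_disc z r = {w. chordal_dist z w < r}"

definition L2_sampling :: "(nat \<Rightarrow> complex set) \<Rightarrow> (nat \<Rightarrow> complex \<Rightarrow> nat) \<Rightarrow> bool" where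
  "L2_sampling \<Lambda> m \<longleftrightarrow> (\<exists>C>0. \<forall>k\<ge>1. \<forall>p :: complex poly. degree p \<le> k \<longrightarrow>
      norm2_k k (poly p) / C
        \<le> (\<Sum>l\<in>\<Lambda> k. \<Sum>j<m k l. (cmod (inner_k k (poly p) (T_k k l (e_k k j))))^2)
    \<and> (\<Sum>l\<in>\<Lambda> k. \<Sum>j<m k l. (cmod (inner_k k (poly p) (T_k k l (e_k k j))))^2)
        \<le> C * norm2_k k (poly p))"

end

(* Write t for the squared chordal distance of z and l.  The pairing of T_z e_0 with T_l e_j has
   squared modulus equal to the binomial weight P(Bin(k, t) = j), so the l-term of the sampling
   sum for the unit vector T_z e_0 is P(Bin(k, t) < m_l).

   (a) If z lies in the disc of l, then k t < m_l and this probability is bounded below by an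
   absolute constant (2 m_l <= k holds for large k), so the upper sampling bound limits the
   number of discs containing z.

   (b) The pairing of T_z e_1 with T_l e_j is that of T_z e_0 multiplied, in modulus, by
   |j - k t| / sqrt (k t (1 - t)).  If z is at distance at least (sqrt m_l + c) / sqrt k from every
   l, this factor is at least c for all j < m_l.  The sampling sum of T_z e_0 is then at most
   C / c^2 by the upper bound for T_z e_1, which for c > C contradicts the lower bound 1 / C. *)

theory Submission
  imports Defs
begin

section \<open>Lower tail of the binomial distribution\<close>

text \<open>Conditioning on the last trial: a binomial variable with k+1 trials is one with k trials
  plus an independent Bernoulli variable, which is Pascal's rule on the weights. Since
  \<open>f\<close> is arbitrary, it drives the inductions for the central moments.\<close>

lemma sum_Bernstein_Suc:
  "(\<Sum>j\<le>Suc k. Bernstein (Suc k) j t * f j) = (\<Sum>j\<le>k. Bernstein k j t * ((1-t) * f j + t * f (Suc j)))"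
proof -
  have "(\<Sum>j\<le>Suc k. Bernstein (Suc k) j t * f j)
      = (1-t)^(Suc k) * f 0 + (\<Sum>j\<le>k. Bernstein (Suc k) (Suc j) t * f (Suc j))"
    by (simp add: sum.atMost_Suc_shift Bernstein_def del: sum.atMost_Suc)
  also have "(\<Sum>j\<le>k. Bernstein (Suc k) (Suc j) t * f (Suc j))
      = (\<Sum>j\<le>k. Bernstein k j t * (t * f (Suc j))) + (\<Sum>j\<le>k. real (k choose Suc j) * t^(Suc j) * (1-t)^(k-j) * f (Suc j))"
    by (simp add: Bernstein_def sum.distrib[symmetric] algebra_simps)
  also have "(\<Sum>j\<le>k. real (k choose Suc j) * t^(Suc j) * (1-t)^(k-j) * f (Suc j))
      = (\<Sum>j\<le>Suc k. real (k choose j) * t^j * (1-t)^(Suc k-j) * f j) - (1-t)^(Suc k) * f 0"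
    by (simp add: sum.atMost_Suc_shift del: sum.atMost_Suc)
  also have "(\<Sum>j\<le>Suc k. real (k choose j) * t^j * (1-t)^(Suc k-j) * f j) = (\<Sum>j\<le>k. Bernstein k j t * ((1-t) * f j))"
    by (auto simp: Bernstein_def Suc_diff_le binomial_eq_0 mult_ac intro!: sum.cong)
  finally show ?thesis
    by (simp add: sum.distrib distrib_left mult_ac del: sum.atMost_Suc)
qed

lemma Bernstein_centred_mean: "(\<Sum>j\<le>k. Bernstein k j t * (real j - real k * t)) = 0"
proof -
  have "(\<Sum>j\<le>k. Bernstein k j t * (real j - real k * t))
     = (\<Sum>j\<le>k. real j * Bernstein k j t) - real k * t * (\<Sum>j\<le>k. Bernstein k j t)"
    by (simp add: right_diff_distrib sum_subtractf sum_distrib_left mult_ac del: sum_Bernstein sum_k_Bernstein)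
  then show ?thesis by simp
qed

lemma Bernstein_variance: "(\<Sum>j\<le>k. Bernstein k j t * (real j - real k * t)^2) = real k * (t * (1-t))"
proof (induction k)
  case 0
  then show ?case by (simp add: Bernstein_def)
next
  case (Suc k)
  have "(\<Sum>j\<le>Suc k. Bernstein (Suc k) j t * (real j - real (Suc k) * t)^2)
     = (\<Sum>j\<le>k. Bernstein k j t * (real j - real k * t)^2 + t * (1-t) * Bernstein k j t)"
    unfolding sum_Bernstein_Suc by (intro sum.cong refl) (simp add: algebra_simps power2_eq_square)
  then show ?case
    by (simp only: sum.distrib Suc.IH sum_distrib_left[symmetric] sum_Bernstein) (simp add: algebra_simps)
qed

text \<open>With v = t (1-t), the exact moment is k v + 3 (k v)^2 - 6 k v^2; an upper bound of the
  right order is all that is needed, and it passes through the induction.\<close>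

lemma Bernstein_fourth_moment:
  assumes "0 \<le> t" "t \<le> 1"
  shows "(\<Sum>j\<le>k. Bernstein k j t * (real j - real k * t)^4)
       \<le> real k * (t * (1-t)) + 3 * (real k * (t * (1-t)))^2"
proof (induction k)
  case 0
  then show ?case by (simp add: Bernstein_def)
next
  case (Suc k)
  define v where "v = t * (1-t)"
  have v: "v \<ge> 0" unfolding v_def using assms by simp
  \<comment> \<open>Expand the fourth power of Y plus one centred Bernoulli variable. The moments of
    the latter of order 1 to 4 are 0, v, v (1 - 2t) and v (1 - 3v).\<close>
  have "(\<Sum>j\<le>Suc k. Bernstein (Suc k) j t * (real j - real (Suc k) * t)^4)
     = (\<Sum>j\<le>k. Bernstein k j t * (real j - real k * t)^4
         + 6 * v * (Bernstein k j t * (real j - real k * t)^2)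
         + 4 * (v * (1 - 2 * t)) * (Bernstein k j t * (real j - real k * t)) + (v * (1 - 3 * v)) * Bernstein k j t)"
    unfolding sum_Bernstein_Suc v_def
  proof (intro sum.cong refl)
    fix j
    define Y where "Y = real j - real k * t"
    have 1: "real j - real (Suc k) * t = Y - t" "real (Suc j) - real (Suc k) * t = Y + (1 - t)"
      by (simp_all add: Y_def algebra_simps)
    show "Bernstein k j t * ((1 - t) * (real j - real (Suc k) * t) ^ 4 + t * (real (Suc j) - real (Suc k) * t) ^ 4) =
         Bernstein k j t * (real j - real k * t) ^ 4 + 6 * (t * (1 - t)) * (Bernstein k j t * (real j - real k * t)\<^sup>2) +
         4 * (t * (1 - t) * (1 - 2 * t)) * (Bernstein k j t * (real j - real k * t)) +
         t * (1 - t) * (1 - 3 * (t * (1 - t))) * Bernstein k j t"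
      unfolding 1 Y_def[symmetric] by algebra
  qed
  also have "\<dots> = (\<Sum>j\<le>k. Bernstein k j t * (real j - real k * t)^4) + 6 * v * (real k * v) + v * (1 - 3 * v)"
    by (simp only: sum.distrib sum_distrib_left[symmetric] sum_Bernstein Bernstein_variance Bernstein_centred_mean)
       (simp add: v_def)
  also have "\<dots> \<le> real k * v + 3 * (real k * v)^2 + 6 * v * (real k * v) + v * (1 - 3 * v)"
    using Suc.IH unfolding v_def by simp
  also have "\<dots> \<le> real (Suc k) * v + 3 * (real (Suc k) * v)^2"
    using v by (simp add: algebra_simps power2_eq_square)
  finally show ?case unfolding v_def .
qed

text \<open>Averaging this minorant of the indicator of the negative half-line over a standardised
  variable bounds its probability of being negative from below in terms of its fourth
  moment alone; the coefficients are tuned to the bound 7 on that moment.\<close>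

lemma quartic_le_of_bool_neg:
  fixes x :: real
  shows "(- (5/4) * x + x^2 - x^4 / 8) / 5 \<le> of_bool (x < 0)"
proof (cases "x < 0")
  case True
  \<comment> \<open>After multiplication by 40 the claim for negative x is that x^4 - 8x^2 + 10x +
    40 is nonnegative. The squares reproduce all terms but the constant, where they stay just below
    40.\<close>
  have "0 \<le> (x^2 - 26/5)^2 + 12/5 * (x + 25/12)^2 + 5/2"
    by simp
  also have "\<dots> \<le> x^4 - 8 * x^2 + 10 * x + 40"
    by (simp add: power2_eq_square power4_eq_xxxx algebra_simps)
  finally show ?thesis using True by simp
next
  case False
  \<comment> \<open>The double root 5/3 certifies a slightly smaller quartic; 8 < 25/3 and 10 >
    250/27 give the required one for x >= 0.\<close>
  have "0 \<le> x * ((x - 5/3)^2 * (x + 10/3))" using False by simp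
  also have "\<dots> = x^4 - 25/3 * x^2 + 250/27 * x"
    by (simp add: power2_eq_square power4_eq_xxxx field_simps)
  finally have "0 \<le> x^4 - 25/3 * x^2 + 250/27 * x" .
  then have "x^4 - 8 * x^2 + 10 * x \<ge> 0" using False zero_le_power2[of x] by linarith
  then show ?thesis using False by simp
qed

text \<open>Average the quartic minorant over the standardised variable. Its first two moments are 0
  and 1; variance s >= 1/4 gives s <= 4 s^2, so the fourth moment is at most 7 and the average is at
  least (1 - 7/8) / 5 = 1/40.\<close>

lemma Bernstein_below_mean:
  assumes t: "0 \<le> t" "t \<le> 1" and var: "real k * (t * (1-t)) \<ge> 1/4"
  shows "(\<Sum>j\<le>k. Bernstein k j t * of_bool (real j < real k * t)) \<ge> 1/40"
proof -
  define s where "s = real k * (t * (1-t))"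
  define \<sigma> where "\<sigma> = sqrt s"
  have s: "s \<ge> 1/4" using var s_def by simp
  have \<sigma>: "\<sigma> > 0" "\<sigma>^2 = s" using s by (auto simp: \<sigma>_def)
  have \<sigma>4: "\<sigma>^4 = s^2" using \<sigma>(2) by (metis mult_2 numeral_Bit0 power_add power2_eq_square)
  define Y where "Y j = real j - real k * t" for j
  have "(\<Sum>j\<le>k. Bernstein k j t * Y j ^ 4) \<le> s + 3 * s^2"
    using Bernstein_fourth_moment[OF t] unfolding Y_def s_def .
  also have "\<dots> \<le> 7 * s^2"
    using s mult_right_mono[of "1/4" s s] by (simp add: power2_eq_square)
  finally have 4: "(\<Sum>j\<le>k. Bernstein k j t * Y j ^ 4) / \<sigma>^4 \<le> 7"
    using s unfolding \<sigma>4 by (simp add: divide_simps)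
  have 2: "(\<Sum>j\<le>k. Bernstein k j t * Y j ^ 2) / \<sigma>^2 = 1"
    using s unfolding \<sigma>(2) Y_def Bernstein_variance s_def[symmetric] by simp
  have 1: "(\<Sum>j\<le>k. Bernstein k j t * Y j) = 0"
    using Bernstein_centred_mean unfolding Y_def .
  have "1/40 \<le> (- (5/4) * ((\<Sum>j\<le>k. Bernstein k j t * Y j) / \<sigma>) + (\<Sum>j\<le>k. Bernstein k j t * Y j ^ 2) / \<sigma>^2
      - (\<Sum>j\<le>k. Bernstein k j t * Y j ^ 4) / \<sigma>^4 / 8) / 5"
    using 4 unfolding 1 2 by simp
  also have "\<dots> = (\<Sum>j\<le>k. Bernstein k j t * ((- (5/4) * (Y j / \<sigma>) + (Y j / \<sigma>)^2 - (Y j / \<sigma>)^4 / 8) / 5))"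
    by (simp add: sum_distrib_left sum_subtractf sum.distrib sum_divide_distrib power_divide algebra_simps sum_negf diff_divide_distrib add_divide_distrib)
  also have "\<dots> \<le> (\<Sum>j\<le>k. Bernstein k j t * of_bool (Y j / \<sigma> < 0))"
    using t by (intro sum_mono mult_left_mono quartic_le_of_bool_neg Bernstein_nonneg) auto
  also have "\<dots> = (\<Sum>j\<le>k. Bernstein k j t * of_bool (real j < real k * t))"
    using \<sigma>(1) by (intro sum.cong refl) (auto simp: Y_def divide_less_0_iff)
  finally show ?thesis .
qed

text \<open>The constant is independent of k, m and t. The condition \<open>2 * m \<le> k\<close>
  keeps t at most 1/2; hence once k t >= m/2 >= 1/2, the variance k t (1-t) reaches the threshold
  1/4 of \<open>Bernstein_below_mean\<close>.\<close>

lemma Bernstein_lower_tail: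
  assumes t: "0 \<le> t" and m: "1 \<le> m" "real k * t < real m" "2 * m \<le> k"
  shows "(\<Sum>j<m. Bernstein k j t) \<ge> 1/40"
proof -
  have k: "real k > 0" using m by simp
  have "real k * t \<le> real k * (1/2)" using m by linarith
  then have t2: "t \<le> 1/2" using k mult_le_cancel_left_pos by blast
  have nn: "Bernstein k j t \<ge> 0" for j using t t2 by (intro Bernstein_nonneg) auto
  have sub: "{..<m} \<subseteq> {..k}" using m by auto
  have eq: "(\<Sum>j<m. Bernstein k j t) = (\<Sum>j\<le>k. Bernstein k j t * of_bool (j < m))"
    by (rule sum.mono_neutral_cong_left) (use sub in auto)
  \<comment> \<open>Far below \<open>m\<close> Markov's inequality suffices; near \<open>m\<close> the variance is bounded below.\<close>
  show ?thesis
  proof (cases "real k * t < real m / 2")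
    case True
    \<comment> \<open>Markov's inequality: 1 - j/m lies below the indicator of j < m, and the mean
      of j/m is less than 1/2.\<close>
    have "(\<Sum>j\<le>k. Bernstein k j t * (1 - real j / real m)) \<le> (\<Sum>j\<le>k. Bernstein k j t * of_bool (j < m))"
      using m by (intro sum_mono mult_left_mono nn) (auto simp: divide_simps)
    moreover have "(\<Sum>j\<le>k. Bernstein k j t * (1 - real j / real m))
       = (\<Sum>j\<le>k. Bernstein k j t) - (\<Sum>j\<le>k. real j * Bernstein k j t) / real m"
      by (simp add: right_diff_distrib sum_subtractf sum_divide_distrib mult_ac del: sum_Bernstein sum_k_Bernstein)
    moreover have "\<dots> \<ge> 1/2"
      using True m by (simp add: divide_simps)
    ultimately show ?thesis using eq by linarith
  next
    case False
    have "1/2 \<le> real k * t" using False m(1) by linarith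
    then have "(1/2) * (1/2) \<le> (real k * t) * (1 - t)"
      using t2 t by (intro mult_mono) auto
    then have "(\<Sum>j\<le>k. Bernstein k j t * of_bool (real j < real k * t)) \<ge> 1/40"
      using t t2 by (intro Bernstein_below_mean) (auto simp: mult.assoc)
    also have "(\<Sum>j\<le>k. Bernstein k j t * of_bool (real j < real k * t)) \<le> (\<Sum>j\<le>k. Bernstein k j t * of_bool (j < m))"
      using m by (intro sum_mono mult_left_mono nn) auto
    finally show ?thesis using eq by simp
  qed
qed

section \<open>The inner product in the monomial basis\<close>

lemma lborel_complex_eq_distr:
  "(lborel :: complex measure) = distr lborel borel (\<lambda>v::real^2. Complex (v$1) (v$2))"
proof (rule lborel_eqI)
  fix l u :: complex
  assume lu: "\<And>b. b \<in> Basis \<Longrightarrow> l \<bullet> b \<le> u \<bullet> b"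
  have meas: "(\<lambda>v::real^2. Complex (v$1) (v$2)) \<in> borel_measurable borel"
    by (intro borel_measurable_continuous_onI continuous_intros)
  have pre: "(\<lambda>v::real^2. Complex (v$1) (v$2)) -` box l u = box (vector [Re l, Im l]) (vector [Re u, Im u])"
    by (auto simp: mem_box_cart forall_2 in_box_complex_iff)
  have lu': "Re l \<le> Re u" "Im l \<le> Im u"
    using lu[of 1] lu[of \<i>] by (simp_all add: Basis_complex_def)
  have "emeasure (distr lborel borel (\<lambda>v::real^2. Complex (v$1) (v$2))) (box l u)
      = emeasure lborel (box (vector [Re l, Im l]) (vector [Re u, Im u]) :: (real^2) set)"
    using meas by (subst emeasure_distr) (auto simp: pre)
  also have "\<dots> = (\<Prod>b\<in>Basis. (u - l) \<bullet> b)"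
    using lu'
    by (subst emeasure_lborel_box)
       (auto simp: Basis_complex_def Basis_vec_def UNIV_2 inner_axis complex_eq_iff axis_eq_axis ac_simps)
  finally show "emeasure (distr lborel borel (\<lambda>v::real^2. Complex (v$1) (v$2))) (box l u) = (\<Prod>b\<in>Basis. (u - l) \<bullet> b)" .
qed simp

text \<open>The library knows the invariance of Lebesgue measure under orthogonal maps only on
  \<open>real ^ 'n\<close>, whence the detour through \<open>real ^ 2\<close>.\<close>

lemma distr_lborel_rotation:
  fixes c :: complex
  assumes c: "cmod c = 1"
  shows "distr lborel borel ((*) c) = lborel"
proof (rule lborel_eqI[symmetric])
  fix l u :: complex
  assume lu: "\<And>b. b \<in> Basis \<Longrightarrow> l \<bullet> b \<le> u \<bullet> b"
  define V where "V = (\<lambda>v::real^2. Complex (v$1) (v$2))"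
  \<comment> \<open>\<open>f\<close> is the inverse rotation in coordinates. The preimage of a box
    under multiplication by c thereby becomes an image under an orthogonal map.\<close>
  define f where "f = (\<lambda>v::real^2. vector [Re (cnj c * V v), Im (cnj c * V v)] :: real^2)"
  have meas: "V \<in> borel_measurable borel" unfolding V_def
    by (intro borel_measurable_continuous_onI continuous_intros)
  have Vf: "V (f v) = cnj c * V v" for v
    by (simp add: V_def f_def complex_eq_iff)
  have cc: "c * cnj c = 1" using c by (simp add: complex_norm_square[symmetric])
  have "Re c ^ 2 + Im c ^ 2 = 1" using c by (simp add: cmod_def)
  then have orth: "orthogonal_transformation f"
    unfolding orthogonal_transformation_def
  proof (intro conjI allI linearI)
    fix v w :: "real^2"
    have "f v \<bullet> f w = (Re c ^ 2 + Im c ^ 2) * (v \<bullet> w)"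
      by (simp add: f_def V_def inner_vec_def sum_2 power2_eq_square algebra_simps)
    then show "f v \<bullet> f w = v \<bullet> w" using \<open>Re c ^ 2 + Im c ^ 2 = 1\<close> by simp
  qed (simp_all add: f_def V_def vec_eq_iff forall_2 algebra_simps)
  have surj: "\<exists>w. f w = v" for v
    using orthogonal_transformation_surj[OF orth] by (metis surjD)
  have invol: "V -` ((*) c -` box l u) = f ` (V -` box l u)"
  proof (intro set_eqI iffI)
    fix v assume v: "v \<in> V -` ((*) c -` box l u)"
    obtain w where w: "f w = v" using surj by blast
    have "c * V v = V w" unfolding w[symmetric] Vf using cc by (metis mult.assoc mult_1)
    with v w show "v \<in> f ` (V -` box l u)" by auto
  next
    fix v assume "v \<in> f ` (V -` box l u)"
    then obtain w where "V w \<in> box l u" "v = f w" by auto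
    moreover have "c * V (f w) = V w" unfolding Vf using cc by (metis mult.assoc mult_1)
    ultimately show "v \<in> V -` ((*) c -` box l u)" by simp
  qed
  have pre: "V -` box l u = box (vector [Re l, Im l]) (vector [Re u, Im u])"
    by (auto simp: mem_box_cart forall_2 in_box_complex_iff V_def)
  have lm: "V -` box l u \<in> lmeasurable" unfolding pre by simp
  have b: "(*) c -` box l u \<in> sets borel"
    using measurable_sets[of "(*) c" borel borel "box l u"] by simp
  have b': "V -` B \<in> sets borel" if "B \<in> sets borel" for B
    using measurable_sets[OF meas that] by simp
  have "emeasure (distr lborel borel ((*) c)) (box l u) = emeasure lborel ((*) c -` box l u)"
    by (subst emeasure_distr) auto
  also have "\<dots> = emeasure lborel (V -` ((*) c -` box l u))"
    using meas b by (subst lborel_complex_eq_distr, subst emeasure_distr) (auto simp: V_def)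
  also have "\<dots> = emeasure lebesgue (f ` (V -` box l u))"
    using b' b by (simp add: invol[symmetric])
  also have "\<dots> = emeasure lebesgue (V -` box l u)"
    using lm measurable_orthogonal_image[OF orth lm] measure_orthogonal_image[OF orth lm]
    by (simp add: emeasure_eq_measure2)
  also have "\<dots> = emeasure lborel (V -` box l u)"
    using b' by simp
  also have "\<dots> = emeasure lborel (box l u)"
    using meas by (subst lborel_complex_eq_distr, subst emeasure_distr) (auto simp: V_def)
  also have "\<dots> = (\<Prod>b\<in>Basis. (u - l) \<bullet> b)"
    using lu by simp
  finally show "emeasure (distr lborel borel ((*) c)) (box l u) = (\<Prod>b\<in>Basis. (u - l) \<bullet> b)" .
qed simp

text \<open>The disc of radius sqrt a has area pi a, so the image measure has constant density on
  the half-line. This replaces polar coordinates; half-lines generate the Borel sets and are stable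
  under intersection.\<close>

lemma distr_lborel_norm_square:
  "distr lborel borel (\<lambda>z::complex. (cmod z)^2) = density lborel (\<lambda>s. ennreal pi * indicator {0..} s)"
proof (rule measure_eqI_generator_eq[of "range (\<lambda>a::real. {..<a})" UNIV _ _ "\<lambda>i. {..<real i}"])
  show "Int_stable (range (\<lambda>a::real. {..<a}))"
  proof (rule Int_stableI_image)
    show "\<exists>k\<in>UNIV. {..<i} \<inter> {..<j} = {..<k}" for i j :: real
      by (intro bexI[of _ "min i j"]) auto
  qed
  fix X assume "X \<in> range (\<lambda>a::real. {..<a})"
  then obtain a where X: "X = {..<a}" by auto
  have "emeasure (distr lborel borel (\<lambda>z::complex. (cmod z)^2)) {..<a}
     = emeasure lborel ((\<lambda>z::complex. (cmod z)^2) -` {..<a})"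
    by (subst emeasure_distr) auto
  also have "(\<lambda>z::complex. (cmod z)^2) -` {..<a} = (if a \<le> 0 then {} else ball 0 (sqrt a))"
    by (auto simp: real_less_rsqrt not_less sqrt_le_D) (metis not_less order_trans zero_le_power2, metis norm_ge_zero real_sqrt_less_iff real_sqrt_abs abs_of_nonneg)
  also have "emeasure lborel \<dots> = ennreal (pi * max 0 a)"
    by (auto simp: emeasure_ball unit_ball_vol_2)
  also have "\<dots> = emeasure (density lborel (\<lambda>s. ennreal pi * indicator {0..} s)) {..<a}"
  proof -
    have "emeasure (density lborel (\<lambda>s. ennreal pi * indicator {0..} s)) {..<a}
      = (\<integral>\<^sup>+s. ennreal pi * indicator {0..<a} s \<partial>lborel)"
      by (subst emeasure_density) (auto intro!: nn_integral_cong simp: indicator_def)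
    also have "\<dots> = ennreal (pi * max 0 a)"
      by (cases "a \<ge> 0") (auto simp: nn_integral_cmult ennreal_mult max_def)
    finally show ?thesis by simp
  qed
  finally show "emeasure (distr lborel borel (\<lambda>z::complex. (cmod z)^2)) X
    = emeasure (density lborel (\<lambda>s. ennreal pi * indicator {0..} s)) X" unfolding X .
next
  fix i :: nat
  have "emeasure (distr lborel borel (\<lambda>z::complex. (cmod z)^2)) {..<real i} = emeasure lborel ((\<lambda>z::complex. (cmod z)^2) -` {..<real i})"
    by (subst emeasure_distr) auto
  also have "\<dots> \<le> emeasure lborel (cball (0::complex) (sqrt (real i)))"
    by (intro emeasure_mono) (auto simp: real_le_rsqrt)
  also have "\<dots> < \<infinity>" using emeasure_bounded_finite[OF bounded_cball] by simp
  finally show "emeasure (distr lborel borel (\<lambda>z::complex. (cmod z)^2)) {..<real i} \<noteq> \<infinity>" by simp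
qed (auto simp: borel_Iio reals_Archimedean2)

section \<open>Beta integrals\<close>

lemma DERIV_inverse_power_Suc:
  assumes "(s::real) \<ge> 0"
  shows "((\<lambda>s. 1 / (1+s)^(k+1)) has_real_derivative - real (k+1) / (1+s)^(k+2)) (at s)"
proof -
  have "((\<lambda>s. 1 + s) has_real_derivative 1) (at s)" by (auto intro!: derivative_eq_intros)
  then have "((\<lambda>s. (1+s)^(k+1)) has_real_derivative real (k+1) * (1+s)^k) (at s)"
    by (rule DERIV_power[THEN DERIV_cong]) simp
  then have "((\<lambda>s. inverse ((1+s)^(k+1))) has_real_derivative
      - (inverse ((1+s)^(k+1)) * (real (k+1) * (1+s)^k) * inverse ((1+s)^(k+1)))) (at s)"
    by (rule DERIV_inverse') (use assms in auto)
  also have "- (inverse ((1+s)^(k+1)) * (real (k+1) * (1+s)^k) * inverse ((1+s)^(k+1))) = - real (k+1) / (1+s)^(k+2)"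
    using assms by (simp add: divide_simps)
  finally show ?thesis by (simp add: inverse_eq_divide)
qed

text \<open>The limit of G is the beta integral B(i+1, k-i+1). Induction on i is integration by
  parts, carried out on antiderivatives so that the fundamental theorem of calculus is applied only
  once.\<close>

lemma antiderivative_beta_kernel:
  assumes "i \<le> k"
  shows "\<exists>G. (\<forall>s\<ge>0. (G has_real_derivative s^i / (1+s)^(k+2)) (at s)) \<and> G 0 = 0
     \<and> (G \<longlongrightarrow> 1 / (real (k+1) * real (k choose i))) at_top"
  using assms
proof (induction i)
  case 0
  define G where "G s = 1 / real (k+1) * (1 - 1 / (1+s)^(k+1))" for s :: real
  have "(G has_real_derivative s^0 / (1+s)^(k+2)) (at s)" if "s \<ge> 0" for s
    unfolding G_def
    by (rule DERIV_cong[OF DERIV_cmult[OF DERIV_diff[OF DERIV_const DERIV_inverse_power_Suc[OF that]]]])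
       (use that in \<open>simp add: divide_simps\<close>)
  moreover have "((\<lambda>s::real. 1 / (1+s)^(k+1)) \<longlongrightarrow> 0) at_top"
    by (intro tendsto_divide_0[OF tendsto_const] filterlim_at_top_imp_at_infinity filterlim_pow_at_top filterlim_tendsto_add_at_top[OF tendsto_const] filterlim_ident) simp
  then have "(G \<longlongrightarrow> 1 / real (k+1) * (1 - 0)) at_top"
    unfolding G_def by (intro tendsto_intros)
  ultimately show ?case by (intro exI[of _ G] conjI) (auto simp: G_def[of 0])
next
  case (Suc i)
  then obtain G where G: "\<And>s. s \<ge> 0 \<Longrightarrow> (G has_real_derivative s^i / (1+s)^(k+2)) (at s)" "G 0 = 0"
     "(G \<longlongrightarrow> 1 / (real (k+1) * real (k choose i))) at_top" by auto
  have ik: "real (k - i) > 0" using Suc by simp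
  \<comment> \<open>The derivative of s^(i+1) / (1+s)^(k+1) is ((i+1) s^i - (k-i) s^(i+1)) /
    (1+s)^(k+2); solving for the second term gives F. The divisor k - i is nonzero because i + 1 <=
    k.\<close>
  define F where "F s = (real (Suc i) * G s - s^(Suc i) / (1+s)^(k+1)) / real (k-i)" for s
  have "(F has_real_derivative s^(Suc i) / (1+s)^(k+2)) (at s)" if s: "s \<ge> 0" for s
  proof -
    have pow: "((\<lambda>s. s^Suc i) has_real_derivative real (Suc i) * s^i) (at s)"
      using DERIV_pow[of "Suc i" s] by simp
    have "((\<lambda>s. real (Suc i) * G s - s^(Suc i) * (1 / (1+s)^(k+1))) has_real_derivative
        real (Suc i) * (s^i / (1+s)^(k+2)) - (real (Suc i) * s^i * (1 / (1+s)^(k+1)) + - real (k+1) / (1+s)^(k+2) * s^(Suc i))) (at s)"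
      by (intro DERIV_diff DERIV_mult DERIV_cmult G s DERIV_inverse_power_Suc pow)
    moreover have "real (Suc i) * (s^i / (1+s)^(k+2)) - (real (Suc i) * s^i * (1 / (1+s)^(k+1)) + - real (k+1) / (1+s)^(k+2) * s^(Suc i))
      = real (k - i) * (s^(Suc i) / (1+s)^(k+2))"
    proof -
      have "1 / (1+s)^(k+1) = (1 + s) / (1+s)^(k+2)" using s by (simp add: divide_simps)
      moreover define D where "D = inverse ((1+s)^(k+2))"
      ultimately have D: "1 / (1+s)^(k+1) = (1 + s) * D" "x / (1+s)^(k+2) = x * D" for x
        by (simp_all add: divide_inverse)
      show ?thesis using Suc.prems
        unfolding D by (simp add: of_nat_diff algebra_simps)
    qed
    ultimately have "((\<lambda>s. (real (Suc i) * G s - s^(Suc i) * (1 / (1+s)^(k+1))) / real (k-i)) has_real_derivative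
        real (k - i) * (s^(Suc i) / (1+s)^(k+2)) / real (k-i)) (at s)"
      by (intro DERIV_cdivide) simp
    then show ?thesis using ik by (simp add: F_def[abs_def])
  qed
  moreover have "((\<lambda>s::real. s^(Suc i) / (1+s)^(k+1)) \<longlongrightarrow> 0) at_top"
  proof (rule tendsto_sandwich)
    show "\<forall>\<^sub>F s::real in at_top. s^(Suc i) / (1+s)^(k+1) \<le> 1 / (1 + s)"
      using eventually_ge_at_top[of 0]
    proof eventually_elim
      case (elim s)
      have "s^(Suc i) \<le> (1+s)^(Suc i)" using elim by (intro power_mono) auto
      also have "\<dots> \<le> (1+s)^k" using elim Suc.prems by (intro power_increasing) auto
      finally show ?case using elim by (simp add: divide_simps)
    qed
    show "\<forall>\<^sub>F s::real in at_top. 0 \<le> s^(Suc i) / (1+s)^(k+1)"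
      using eventually_ge_at_top[of 0] by eventually_elim simp
    show "((\<lambda>s::real. 1 / (1+s)) \<longlongrightarrow> 0) at_top"
      by (intro tendsto_divide_0[OF tendsto_const] filterlim_at_top_imp_at_infinity filterlim_tendsto_add_at_top[OF tendsto_const] filterlim_ident)
  qed simp
  then have "(F \<longlongrightarrow> (real (Suc i) * (1 / (real (k+1) * real (k choose i))) - 0) / real (k-i)) at_top"
    unfolding F_def using ik by (intro tendsto_intros G) auto
  moreover have "(real (Suc i) * (1 / (real (k+1) * real (k choose i))) - 0) / real (k-i) = 1 / (real (k+1) * real (k choose Suc i))"
  proof -
    have "real (Suc i) * real (k choose Suc i) = real (k - i) * real (k choose i)"
      using binomial_absorption[of i k] binomial_absorb_comp[of k i] by (metis of_nat_mult)
    moreover have "(real (Suc i) * (1 / (real (k+1) * real (k choose i))) - 0) / real (k-i)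
        = real (Suc i) / (real (k+1) * (real (k - i) * real (k choose i)))"
      by simp
    ultimately have "(real (Suc i) * (1 / (real (k+1) * real (k choose i))) - 0) / real (k-i)
        = real (Suc i) / (real (k+1) * (real (Suc i) * real (k choose Suc i)))"
      by (simp only:)
    then show ?thesis by (simp del: of_nat_Suc of_nat_add)
  qed
  ultimately show ?case using G(2) by (intro exI[of _ F] conjI) (auto simp: F_def[of 0])
qed

lemma beta_kernel_nn_integral:
  assumes "i \<le> k"
  shows "(\<integral>\<^sup>+s. ennreal (s^i / (1+s)^(k+2)) * indicator {0..} s \<partial>lborel) = 1 / (real (k+1) * real (k choose i))"
proof -
  obtain G where G: "\<And>s. s \<ge> 0 \<Longrightarrow> (G has_real_derivative s^i / (1+s)^(k+2)) (at s)" "G 0 = 0"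
     "(G \<longlongrightarrow> 1 / (real (k+1) * real (k choose i))) at_top"
    using antiderivative_beta_kernel[OF assms] by auto
  show ?thesis
    by (subst nn_integral_FTC_atLeast[of _ 0 G]) (use G in auto)
qed

lemma has_bochner_integral_monomial_square:
  assumes "i \<le> k"
  shows "has_bochner_integral lborel (\<lambda>z::complex. ((cmod z)^2)^i / (pi * (1 + (cmod z)^2)^(k+2)))
           (1 / (real (k+1) * real (k choose i)))"
proof (rule has_bochner_integral_nn_integral)
  have "(\<integral>\<^sup>+z. ennreal (((cmod z)^2)^i / (pi * (1 + (cmod z)^2)^(k+2))) \<partial>(lborel :: complex measure))
     = (\<integral>\<^sup>+s. ennreal (s^i / (pi * (1 + s)^(k+2))) \<partial>(distr lborel borel (\<lambda>z::complex. (cmod z)^2)))"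
    by (subst nn_integral_distr) auto
  also have "\<dots> = (\<integral>\<^sup>+s. ennreal pi * indicator {0..} s * ennreal (s^i / (pi * (1 + s)^(k+2))) \<partial>lborel)"
    unfolding distr_lborel_norm_square by (subst nn_integral_density) auto
  also have "\<dots> = (\<integral>\<^sup>+s. ennreal (s^i / (1+s)^(k+2)) * indicator {0..} s \<partial>lborel)"
    by (intro nn_integral_cong) (auto simp: indicator_def ennreal_mult'[symmetric])
  also have "\<dots> = ennreal (1 / (real (k+1) * real (k choose i)))"
    by (rule beta_kernel_nn_integral[OF assms])
  finally show "(\<integral>\<^sup>+z. ennreal (((cmod z)^2)^i / (pi * (1 + (cmod z)^2)^(k+2))) \<partial>(lborel :: complex measure))
     = ennreal (1 / (real (k+1) * real (k choose i)))" .
qed auto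

section \<open>Orthogonality of the monomials and the coefficient formula\<close>

lemma integral_rotation_invariant:
  fixes f :: "complex \<Rightarrow> complex"
  assumes "f \<in> borel_measurable borel" and "cmod c = 1"
  shows "(LINT z|lborel. f (c * z)) = (LINT z|lborel. f z)"
proof -
  have "(LINT z|distr lborel borel ((*) c). f z) = (LINT z|lborel. f (c * z))"
    using assms(1) by (intro integral_distr) auto
  then show ?thesis by (simp add: distr_lborel_rotation[OF assms(2)])
qed

lemma measurable_inner_k_monomials:
  "(\<lambda>z::complex. z^i * cnj (z^j) / complex_of_real (pi * (1 + (cmod z)^2)^(k+2))) \<in> borel_measurable borel"
proof -
  have "1 + (cmod z)^2 \<noteq> 0" for z :: complex
    using zero_le_power2[of "cmod z"] by linarith
  then show ?thesis
    by (intro borel_measurable_continuous_onI continuous_intros ballI) (simp only: of_real_eq_0_iff mult_eq_0_iff power_eq_0_iff pi_neq_zero, simp)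
qed

text \<open>The diagonal values are the beta integrals; off the diagonal a single rotation replaces
  integration over the angle.\<close>

lemma inner_k_monomials:
  assumes "i \<le> k" "j \<le> k"
  shows "inner_k k (\<lambda>z. z^i) (\<lambda>z. z^j) = (if i = j then 1 / of_nat (k choose i) else 0)"
proof (cases "i = j")
  case True
  have eq: "z^i * cnj (z^i) / complex_of_real (pi * (1 + (cmod z)^2)^(k+2))
     = complex_of_real (((cmod z)^2)^i / (pi * (1 + (cmod z)^2)^(k+2)))" for z
  proof -
    have "z^i * cnj (z^i) = complex_of_real (((cmod z)^2)^i)"
      by (metis complex_cnj_power complex_norm_square of_real_power power_mult_distrib)
    then show ?thesis by (simp only: of_real_divide)
  qed
  have "(LINT z|lborel. z^i * cnj (z^i) / complex_of_real (pi * (1 + (cmod z)^2)^(k+2)))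
     = complex_of_real (1 / (real (k+1) * real (k choose i)))"
    unfolding eq integral_complex_of_real has_bochner_integral_integral_eq[OF has_bochner_integral_monomial_square[OF assms(1)]] ..
  then show ?thesis using True of_nat_neq_0[of k, where 'a=complex] by (simp add: inner_k_def del: of_nat_Suc)
next
  case False
  define f where "f z = z^i * cnj (z^j) / complex_of_real (pi * (1 + (cmod z)^2)^(k+2))" for z
  \<comment> \<open>rotation by this angle changes the sign of the integrand\<close>
  define c where "c = cis (pi / (real i - real j))"
  have c: "cmod c = 1" by (simp add: c_def)
  have "c^i * cnj (c^j) = cis (real i * (pi / (real i - real j)) - real j * (pi / (real i - real j)))"
    by (simp only: c_def complex_cnj_power cis_cnj Complex.DeMoivre cis_mult) (simp add: algebra_simps)
  also have "real i * (pi / (real i - real j)) - real j * (pi / (real i - real j)) = pi"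
    using False by (simp add: diff_divide_distrib[symmetric] left_diff_distrib[symmetric])
  finally have neg: "c^i * cnj (c^j) = -1" by simp
  have "f (c * z) = - f z" for z
  proof -
    have "f (c * z) = (c^i * cnj (c^j)) * f z"
      unfolding f_def using c by (simp add: norm_mult power_mult_distrib)
    then show ?thesis unfolding neg by simp
  qed
  moreover have "f \<in> borel_measurable borel" unfolding f_def by (rule measurable_inner_k_monomials)
  ultimately have "- (LINT z|lborel. f z) = (LINT z|lborel. f z)"
    using integral_rotation_invariant[of f c] c by simp
  then have "(LINT z|lborel. f z) = 0" by simp
  then show ?thesis using False unfolding inner_k_def f_def by simp
qed

text \<open>Domination by diagonal terms: |z|^(i+j) <= |z|^(2i) + |z|^(2j).\<close>

lemma integrable_monomials:
  assumes "i \<le> k" "j \<le> k"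
  shows "integrable lborel (\<lambda>z::complex. z^i * cnj (z^j) / complex_of_real (pi * (1 + (cmod z)^2)^(k+2)))"
proof (rule Bochner_Integration.integrable_bound)
  show "integrable lborel (\<lambda>z::complex. ((cmod z)^2)^i / (pi * (1 + (cmod z)^2)^(k+2))
      + ((cmod z)^2)^j / (pi * (1 + (cmod z)^2)^(k+2)))"
    using assms has_bochner_integral_monomial_square[unfolded has_bochner_integral_iff]
    by (intro Bochner_Integration.integrable_add) blast+
  show "AE z in lborel. norm (z^i * cnj (z^j) / complex_of_real (pi * (1 + (cmod z)^2)^(k+2)))
     \<le> norm (((cmod z)^2)^i / (pi * (1 + (cmod z)^2)^(k+2)) + ((cmod z)^2)^j / (pi * (1 + (cmod z)^2)^(k+2)))"
  proof (intro AE_I2)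
    fix z :: complex
    have D: "pi * (1 + (cmod z)^2)^(k+2) > 0" by (simp add: add_pos_nonneg)
    have "2 * (cmod z ^ i * cmod z ^ j) \<le> (cmod z ^ i)^2 + (cmod z ^ j)^2"
      using sum_squares_bound by (simp add: mult.assoc)
    moreover have "0 \<le> cmod z ^ i * cmod z ^ j" by simp
    ultimately have "cmod z ^ i * cmod z ^ j \<le> (cmod z ^ i)^2 + (cmod z ^ j)^2" by linarith
    then have le: "cmod z ^ i * cmod z ^ j \<le> ((cmod z)^2)^i + ((cmod z)^2)^j"
      by (simp add: power_mult[symmetric] mult.commute)
    have "norm (z^i * cnj (z^j) / complex_of_real (pi * (1 + (cmod z)^2)^(k+2)))
      = cmod z ^ i * cmod z ^ j / (pi * (1 + (cmod z)^2)^(k+2))"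
      using D by (simp only: norm_divide norm_mult norm_power complex_mod_cnj norm_of_real abs_of_pos)
    also have "\<dots> \<le> (((cmod z)^2)^i + ((cmod z)^2)^j) / (pi * (1 + (cmod z)^2)^(k+2))"
      using D le by (intro divide_right_mono) auto
    also have "\<dots> \<le> norm (\<dots>)" by simp
    finally show "norm (z^i * cnj (z^j) / complex_of_real (pi * (1 + (cmod z)^2)^(k+2)))
     \<le> norm (((cmod z)^2)^i / (pi * (1 + (cmod z)^2)^(k+2)) + ((cmod z)^2)^j / (pi * (1 + (cmod z)^2)^(k+2)))"
      by (simp add: add_divide_distrib)
  qed
qed (use measurable_inner_k_monomials[of i j k] in simp)

text \<open>From here on pairings of polynomials are finite sums, the weights being the squared
  norms of the monomials.\<close>

lemma inner_k_poly:
  assumes "degree p \<le> k" "degree q \<le> k"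
  shows "inner_k k (poly p) (poly q) = (\<Sum>i\<le>k. coeff p i * cnj (coeff q i) / of_nat (k choose i))"
proof -
  have ex: "poly r z = (\<Sum>i\<le>k. coeff r i * z^i)" if "degree r \<le> k" for r :: "complex poly" and z
    unfolding poly_altdef using that
    by (intro sum.mono_neutral_left) (auto simp: coeff_eq_0)
  define f where "f i j = (\<lambda>z::complex. z^i * cnj (z^j) / complex_of_real (pi * (1 + (cmod z)^2)^(k+2)))" for i j
  have int: "integrable lborel (f i j)" if "i \<le> k" "j \<le> k" for i j
    using integrable_monomials[OF that] unfolding f_def .
  have val: "of_nat (k+1) * (LINT z|lborel. f i j z) = (if i = j then 1 / of_nat (k choose i) else 0)" if "i \<le> k" "j \<le> k" for i j
    using inner_k_monomials[OF that] unfolding f_def inner_k_def .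
  have eq: "poly p z * cnj (poly q z) / complex_of_real (pi * (1 + (cmod z)^2)^(k+2))
    = (\<Sum>i\<le>k. \<Sum>j\<le>k. coeff p i * cnj (coeff q j) * f i j z)" for z
    unfolding ex[OF assms(1)] ex[OF assms(2)] f_def cnj_sum sum_product sum_divide_distrib
    by (intro sum.cong refl) simp
  have "inner_k k (poly p) (poly q) = of_nat (k+1) * (\<Sum>i\<le>k. \<Sum>j\<le>k. coeff p i * cnj (coeff q j) * (LINT z|lborel. f i j z))"
    unfolding inner_k_def eq
  proof -
    have "(LINT z|lborel. (\<Sum>i\<le>k. \<Sum>j\<le>k. coeff p i * cnj (coeff q j) * f i j z))
      = (\<Sum>i\<le>k. LINT z|lborel. (\<Sum>j\<le>k. coeff p i * cnj (coeff q j) * f i j z))"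
      by (intro Bochner_Integration.integral_sum Bochner_Integration.integrable_sum integrable_mult_right int) auto
    also have "\<dots> = (\<Sum>i\<le>k. \<Sum>j\<le>k. LINT z|lborel. coeff p i * cnj (coeff q j) * f i j z)"
      by (intro sum.cong refl Bochner_Integration.integral_sum integrable_mult_right int) auto
    finally show "of_nat (k+1) * (LINT z|lborel. (\<Sum>i\<le>k. \<Sum>j\<le>k. coeff p i * cnj (coeff q j) * f i j z))
      = of_nat (k+1) * (\<Sum>i\<le>k. \<Sum>j\<le>k. coeff p i * cnj (coeff q j) * (LINT z|lborel. f i j z))"
      by simp
  qed
  also have "\<dots> = (\<Sum>i\<le>k. \<Sum>j\<le>k. coeff p i * cnj (coeff q j) * (of_nat (k+1) * (LINT z|lborel. f i j z)))"
    by (simp add: sum_distrib_left mult_ac)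
  also have "\<dots> = (\<Sum>i\<le>k. \<Sum>j\<le>k. if i = j then coeff p i * cnj (coeff q j) / of_nat (k choose i) else 0)"
    by (intro sum.cong refl, subst val) auto
  also have "\<dots> = (\<Sum>i\<le>k. coeff p i * cnj (coeff q i) / of_nat (k choose i))"
    by simp
  finally show ?thesis .
qed

section \<open>The reproducing kernel and its derivative\<close>

text \<open>\<open>T_k k l (e_k k j)\<close> is a polynomial only off the pole of \<open>phi l\<close>, where division by zero
  yields a junk value; \<open>T_poly k j l\<close> is its polynomial continuation for \<open>j \<le> k\<close>.\<close>

definition T_poly :: "nat \<Rightarrow> nat \<Rightarrow> complex \<Rightarrow> complex poly" where
  "T_poly k j l = smult (complex_of_real (sqrt (real (k choose j)) / (1 + (cmod l)^2) powr (real k / 2)))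
     ([:1, cnj l:]^(k-j) * [:l, -1:]^j)"

lemma degree_T_poly: "j \<le> k \<Longrightarrow> degree (T_poly k j l) \<le> k"
proof -
  assume "j \<le> k"
  have "degree ([:1, cnj l:]^(k-j)) \<le> 1 * (k-j)" by (rule order.trans[OF degree_power_le]) simp
  moreover have "degree ([:l, -1:]^j) \<le> 1 * j" by (rule order.trans[OF degree_power_le]) simp
  ultimately have "degree ([:1, cnj l:]^(k-j) * [:l, -1:]^j) \<le> (k - j) + j"
    using degree_mult_le[of "[:1, cnj l:]^(k-j)" "[:l, -1:]^j"] by linarith
  then show ?thesis using \<open>j \<le> k\<close> unfolding T_poly_def
    by (intro order.trans[OF degree_smult_le]) simp
qed

lemma T_k_eq_T_poly:
  assumes "j \<le> k" "1 + cnj l * z \<noteq> 0"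
  shows "T_k k l (e_k k j) z = poly (T_poly k j l) z"
proof -
  have "(1 + cnj l * z)^k = (1 + cnj l * z)^(k-j) * (1 + cnj l * z)^j"
    using assms(1) by (simp add: power_add[symmetric])
  then show ?thesis
    using assms(2) by (simp add: T_k_def e_k_def phi_def T_poly_def power_divide mult.commute)
qed

text \<open>The two functions differ at most at the pole of \<open>phi l\<close>, a null set, so the
  integral does not see the junk value.\<close>

lemma inner_k_T_k:
  assumes "j \<le> k"
  shows "inner_k k (poly p) (T_k k l (e_k k j)) = inner_k k (poly p) (poly (T_poly k j l))"
proof -
  have [measurable]: "poly q \<in> borel_measurable borel" for q :: "complex poly"
    by (intro borel_measurable_continuous_onI continuous_on_poly continuous_on_id)
  have [measurable]: "cnj \<in> borel_measurable borel"
    by (intro borel_measurable_continuous_onI continuous_on_cnj continuous_on_id)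
  have [measurable]: "T_k k l (e_k k j) \<in> borel_measurable borel"
    unfolding T_k_def[abs_def] e_k_def phi_def by measurable
  \<comment> \<open>For l = 0 there is no pole; the excluded point is then 0 by the convention for
    division, which is harmless.\<close>
  have "AE z in lborel. z \<noteq> - 1 / cnj l"
    by (rule AE_lborel_singleton)
  then have "AE z in lborel. T_k k l (e_k k j) z = poly (T_poly k j l) z"
  proof eventually_elim
    case (elim z)
    have "1 + cnj l * z \<noteq> 0"
    proof
      assume 0: "1 + cnj l * z = 0"
      then have "l \<noteq> 0" by auto
      with 0 have "z = -1 / cnj l"
        by (simp add: nonzero_eq_divide_eq add_eq_0_iff mult.commute del: divide_minus_left)
      with elim show False by simp
    qed
    then show ?case by (rule T_k_eq_T_poly[OF assms])
  qed
  then show ?thesis unfolding inner_k_def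
    by (intro arg_cong[where f="\<lambda>x. of_nat (k+1) * x"] integral_cong_AE) (measurable, auto)
qed

text \<open>The sampling sum runs over all j below the multiplicity, which may exceed k + 1; such
  terms vanish with the binomial coefficient.\<close>

lemma T_k_e_k_eq_0: "k < j \<Longrightarrow> T_k k l (e_k k j) = (\<lambda>z. 0)"
  by (simp add: T_k_def[abs_def] e_k_def[abs_def] binomial_eq_0)

lemma inner_k_poly_cnj:
  assumes "degree p \<le> k" "degree q \<le> k"
  shows "inner_k k (poly q) (poly p) = cnj (inner_k k (poly p) (poly q))"
  using assms by (simp add: inner_k_poly mult.commute)

lemma inner_k_poly_smult_right:
  assumes "degree p \<le> k" "degree q \<le> k"
  shows "inner_k k (poly p) (poly (smult c q)) = cnj c * inner_k k (poly p) (poly q)"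
proof -
  have "degree (smult c q) \<le> k" using assms(2) degree_smult_le order.trans by blast
  then show ?thesis using assms by (simp add: inner_k_poly sum_distrib_left mult_ac)
qed

lemma inner_k_poly_diff_right:
  assumes "degree p \<le> k" "degree q \<le> k" "degree r \<le> k"
  shows "inner_k k (poly p) (poly (q - r)) = inner_k k (poly p) (poly q) - inner_k k (poly p) (poly r)"
proof -
  have "degree (q - r) \<le> k" using assms degree_diff_le by blast
  then show ?thesis using assms by (simp add: inner_k_poly sum_subtractf diff_divide_distrib algebra_simps)
qed

lemma degree_linear_power_le:
  fixes a b :: "'a :: comm_semiring_1"
  shows "degree ([:a, b:] ^ n) \<le> n"
  by (rule order.trans[OF degree_power_le]) simp

lemma poly_eq_sum_le:
  fixes z :: "'a :: comm_semiring_1"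
  assumes "degree p \<le> n"
  shows "poly p z = (\<Sum>i\<le>n. coeff p i * z^i)"
  unfolding poly_altdef using assms
  by (intro sum.mono_neutral_left) (auto simp: coeff_eq_0)

text \<open>The coefficients of the kernel (1 + cnj z * w)^k contain exactly the binomials that
  cancel the weights of the inner product.\<close>

lemma inner_k_kernel:
  assumes "degree p \<le> k"
  shows "inner_k k (poly p) (poly ([:1, cnj z:]^k)) = poly p z"
  using assms
  by (simp add: inner_k_poly degree_linear_power_le poly_eq_sum_le[OF assms] coeff_linear_poly_power)

text \<open>The polynomial w (1 + cnj z * w)^(k-1) is 1/k times the derivative of the kernel with
  respect to cnj z, so pairing with it evaluates the derivative of p.\<close>

lemma inner_k_kernel_deriv:
  assumes "degree p \<le> k" "k \<ge> 1"
  shows "inner_k k (poly p) (poly (pCons 0 ([:1, cnj z:]^(k-1)))) = poly (pderiv p) z / of_nat k"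
proof -
  obtain n where k: "k = Suc n" using assms(2) by (cases k) auto
  have dp: "degree (pderiv p) \<le> n" using assms(1) by (simp add: degree_pderiv k)
  have dq: "degree (pCons 0 ([:1, cnj z:]^(k-1))) \<le> k"
    using degree_linear_power_le[of 1 "cnj z" n] by (simp add: k degree_pCons_eq_if)
  have "inner_k k (poly p) (poly (pCons 0 ([:1, cnj z:]^(k-1))))
      = (\<Sum>i\<le>n. coeff p (Suc i) * cnj (coeff ([:1, cnj z:]^n) i) / of_nat (Suc n choose Suc i))"
    using assms(1) dq by (simp add: inner_k_poly k sum.atMost_Suc_shift del: sum.atMost_Suc binomial_Suc_Suc)
  also have "\<dots> = (\<Sum>i\<le>n. coeff (pderiv p) i * z^i / of_nat k)"
  proof (intro sum.cong refl)
    fix i assume i: "i \<in> {..n}"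
    have ch: "of_nat (Suc i) * of_nat (Suc n choose Suc i) = of_nat (Suc n) * (of_nat (n choose i) :: complex)"
      by (metis Suc_times_binomial_eq of_nat_mult mult.commute)
    have nz: "of_nat (Suc n choose Suc i) \<noteq> (0::complex)" "of_nat (Suc n) \<noteq> (0::complex)"
      using i by (simp_all del: binomial_Suc_Suc of_nat_Suc)
    show "coeff p (Suc i) * cnj (coeff ([:1, cnj z:]^n) i) / of_nat (Suc n choose Suc i) = coeff (pderiv p) i * z^i / of_nat k"
      using i nz ch unfolding k
      by (simp add: coeff_linear_poly_power coeff_pderiv frac_eq_eq del: binomial_Suc_Suc of_nat_Suc)
  qed
  also have "\<dots> = poly (pderiv p) z / of_nat k"
    by (simp add: poly_eq_sum_le[OF dp] sum_divide_distrib)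
  finally show ?thesis .
qed

lemma inner_k_T_poly_0:
  assumes "degree p \<le> k"
  shows "inner_k k (poly p) (poly (T_poly k 0 z)) = poly p z / complex_of_real ((1 + (cmod z)^2) powr (real k / 2))"
  unfolding T_poly_def using assms
  by (simp add: inner_k_poly_smult_right degree_linear_power_le inner_k_kernel)

lemma inner_k_T_poly_1:
  assumes "degree p \<le> k" "k \<ge> 1"
  shows "inner_k k (poly p) (poly (T_poly k 1 z))
    = complex_of_real (sqrt (real k) / (1 + (cmod z)^2) powr (real k / 2))
      * (cnj z * poly p z - (1 + z * cnj z) * poly (pderiv p) z / of_nat k)"
proof -
  obtain n where k: "k = Suc n" using assms(2) by (cases k) auto
  \<comment> \<open>From z - w = z (1 + cnj z * w) - (1 + |z|^2) w: the vector T_z e_1 is a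
    combination of the kernel and its derivative.\<close>
  have eq: "[:1, cnj z:]^(k-1) * [:z, -1:]^1
    = smult z ([:1, cnj z:]^k) - smult (1 + z * cnj z) (pCons 0 ([:1, cnj z:]^(k-1)))"
  proof -
    have "[:z, -1:] = smult z [:1, cnj z:] - smult (1 + z * cnj z) [:0, 1:]" by simp
    then have "[:1, cnj z:]^n * [:z, -1:] = smult z ([:1, cnj z:]^n * [:1, cnj z:]) - smult (1 + z * cnj z) ([:1, cnj z:]^n * [:0, 1:])"
      by (simp only: right_diff_distrib mult_smult_right)
    then show ?thesis by (simp add: k mult.commute)
  qed
  have d1: "degree ([:1, cnj z:]^k) \<le> k" by (rule degree_linear_power_le)
  have d2: "degree (pCons 0 ([:1, cnj z:]^(k-1))) \<le> k"
    using degree_linear_power_le[of 1 "cnj z" n] by (simp add: k degree_pCons_eq_if)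
  have d3: "degree (smult c q) \<le> k" if "degree q \<le> k" for c and q :: "complex poly"
    using that degree_smult_le order.trans by blast
  show ?thesis unfolding T_poly_def eq
    using assms d1 d2
    by (simp add: inner_k_poly_smult_right inner_k_poly_diff_right d3 degree_diff_le inner_k_kernel
        inner_k_kernel_deriv[unfolded One_nat_def] mult.commute del: smult_pCons)
qed

section \<open>Norms of the two test vectors\<close>

lemma powr_half_square:
  fixes x :: real
  assumes "x > 0"
  shows "(x powr (real k / 2))^2 = x ^ k"
  using assms
  by (simp add: power2_eq_square powr_add[symmetric] powr_realpow)

lemma one_plus_cmod_square_pos: "1 + (cmod z)^2 > 0"
  using zero_le_power2[of "cmod z"] by linarith

lemma norm2_T_poly_0: "norm2_k k (poly (T_poly k 0 z)) = 1"
proof -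
  define N where "N = (1 + (cmod z)^2) powr (real k / 2)"
  have N: "N^2 = (1 + (cmod z)^2)^k" "N \<noteq> 0"
    using powr_half_square[OF one_plus_cmod_square_pos] one_plus_cmod_square_pos[of z] by (auto simp: N_def)
  have "poly (T_poly k 0 z) z = complex_of_real ((1 + (cmod z)^2)^k / N)"
    by (simp add: T_poly_def N_def[symmetric] complex_norm_square mult.commute del: of_real_power)
       (simp add: complex_norm_square[symmetric] mult.commute)
  then have "inner_k k (poly (T_poly k 0 z)) (poly (T_poly k 0 z)) = complex_of_real ((1 + (cmod z)^2)^k / N / N)"
    by (subst inner_k_T_poly_0) (auto simp: degree_T_poly N_def[symmetric])
  also have "\<dots> = 1" unfolding N(1)[symmetric] using N(2) by (simp add: power2_eq_square)
  finally show ?thesis by (simp add: norm2_k_def)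
qed

text \<open>The reproducing formula is applied to the vector itself, in place of unitarity of T_z.
  The vector vanishes at z, so only the derivative term survives.\<close>

lemma norm2_T_poly_1:
  assumes "k \<ge> 1"
  shows "norm2_k k (poly (T_poly k 1 z)) = 1"
proof -
  define N where "N = (1 + (cmod z)^2) powr (real k / 2)"
  define Z where "Z = 1 + z * cnj z"
  have Z: "Z = complex_of_real (1 + (cmod z)^2)" by (simp only: Z_def of_real_add of_real_1 complex_norm_square)
  have Z0: "Z \<noteq> 0" unfolding Z of_real_eq_0_iff using one_plus_cmod_square_pos[of z] by linarith
  have N: "complex_of_real N^2 = Z^k"
    unfolding Z of_real_power[symmetric] N_def powr_half_square[OF one_plus_cmod_square_pos] ..
  have k: "Suc (k - 1) = k" using assms by simp
  have p0: "poly (T_poly k 1 z) z = 0" by (simp add: T_poly_def)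
  have p1: "poly (pderiv (T_poly k 1 z)) z = - complex_of_real (sqrt (real k) / N) * Z^(k-1)"
  proof -
    have T: "T_poly k 1 z = smult (complex_of_real (sqrt (real k) / N)) ([:1, cnj z:]^(k-1) * [:z, -1:])"
      by (simp add: T_poly_def N_def)
    have "poly [:z, -1:] z = 0" "poly (pderiv [:z, -1:]) z = -1" "poly ([:1, cnj z:]^(k-1)) z = Z^(k-1)"
      by (simp_all add: pderiv_pCons Z_def)
    then show ?thesis
      unfolding T pderiv_smult pderiv_mult poly_smult poly_add poly_mult by simp
  qed
  have "inner_k k (poly (T_poly k 1 z)) (poly (T_poly k 1 z))
     = complex_of_real (sqrt (real k) / N) * (Z * (complex_of_real (sqrt (real k) / N) * Z^(k-1)) / of_nat k)"
    unfolding inner_k_T_poly_1[OF degree_T_poly[OF assms] assms] p0 p1 N_def[symmetric] Z_def[symmetric] by simp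
  also have "\<dots> = complex_of_real (sqrt (real k))^2 * (Z * Z^(k-1)) / (of_nat k * complex_of_real N^2)"
    by (simp add: power2_eq_square mult_ac)
  also have "Z * Z^(k-1) = Z^k" by (metis k power_Suc)
  also have "complex_of_real (sqrt (real k))^2 = of_nat k"
    by (metis of_nat_0_le_iff of_real_of_nat_eq of_real_power real_sqrt_pow2)
  also have "of_nat k * Z^k / (of_nat k * complex_of_real N^2) = 1"
    unfolding N using Z0 assms by simp
  finally show ?thesis by (simp add: norm2_k_def)
qed

section \<open>Chordal distance and the pairings as binomial weights\<close>

lemma chordal_dist_square:
  "(chordal_dist l z)^2 * ((1 + (cmod l)^2) * (1 + (cmod z)^2)) = (cmod (l - z))^2"
  using one_plus_cmod_square_pos[of l] one_plus_cmod_square_pos[of z]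
  by (simp add: chordal_dist_def power_divide power_mult_distrib)

text \<open>From |1 + cnj l * z|^2 + |l - z|^2 = (1 + |l|^2) (1 + |z|^2). The two factors of
  \<open>T_poly\<close> thus carry the failure and success probabilities 1 - t and t.\<close>

lemma chordal_dist_square_compl:
  "(1 - (chordal_dist l z)^2) * ((1 + (cmod l)^2) * (1 + (cmod z)^2)) = (cmod (1 + cnj l * z))^2"
proof -
  have "(cmod (1 + cnj l * z))^2 + (cmod (l - z))^2 = (1 + (cmod l)^2) * (1 + (cmod z)^2)"
    by (simp add: cmod_power2) (simp add: power2_eq_square algebra_simps)
  then show ?thesis using chordal_dist_square[of l z] by (simp add: algebra_simps)
qed

lemma chordal_dist_square_le_1: "(chordal_dist l z)^2 \<le> 1"
proof (rule ccontr)
  assume "\<not> ?thesis"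
  then have "(1 - (chordal_dist l z)^2) * ((1 + (cmod l)^2) * (1 + (cmod z)^2)) < 0"
    by (intro mult_neg_pos mult_pos_pos one_plus_cmod_square_pos) simp
  then show False unfolding chordal_dist_square_compl by simp
qed

lemma cmod_poly_T_poly_square:
  assumes "j \<le> k"
  shows "(cmod (poly (T_poly k j l) z))^2 = Bernstein k j ((chordal_dist l z)^2) * (1 + (cmod z)^2)^k"
proof -
  define L Z t where "L = 1 + (cmod l)^2" and "Z = 1 + (cmod z)^2" and "t = (chordal_dist l z)^2"
  have L: "L > 0" unfolding L_def by (rule one_plus_cmod_square_pos)
  have "(cmod (poly (T_poly k j l) z))^2
     = real (k choose j) / (L powr (real k / 2))^2 * (((cmod (1 + cnj l * z))^2)^(k-j) * ((cmod (l - z))^2)^j)"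
    by (simp add: T_poly_def norm_mult norm_power norm_divide power_mult_distrib power_divide L_def
       mult.commute[of z] flip: power_mult) (simp add: mult.commute)
  also have "\<dots> = real (k choose j) / L^k * (((1 - t) * (L * Z))^(k-j) * (t * (L * Z))^j)"
    unfolding powr_half_square[OF L] chordal_dist_square_compl[symmetric] chordal_dist_square[symmetric]
    by (simp add: L_def Z_def t_def)
  also have "\<dots> = Bernstein k j t * ((L * Z)^(k-j) * (L * Z)^j) / L^k"
    unfolding Bernstein_def power_mult_distrib[of _ "L * Z"] by simp
  also have "(L * Z)^(k-j) * (L * Z)^j = L^k * Z^k"
    using assms by (simp add: power_add[symmetric] power_mult_distrib[symmetric])
  also have "Bernstein k j t * (L^k * Z^k) / L^k = Bernstein k j t * Z^k"
    using L by simp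
  finally show ?thesis by (simp add: t_def Z_def)
qed

lemma cmod_inner_T_poly_0_square:
  assumes "j \<le> k"
  shows "(cmod (inner_k k (poly (T_poly k 0 z)) (poly (T_poly k j l))))^2 = Bernstein k j ((chordal_dist l z)^2)"
proof -
  have "(cmod (inner_k k (poly (T_poly k 0 z)) (poly (T_poly k j l))))^2
      = (cmod (poly (T_poly k j l) z))^2 / ((1 + (cmod z)^2) powr (real k / 2))^2"
    by (subst inner_k_poly_cnj)
       (simp_all add: assms degree_T_poly inner_k_T_poly_0 norm_divide power_divide)
  then show ?thesis
    using one_plus_cmod_square_pos[of z]
    by (simp add: cmod_poly_T_poly_square[OF assms] powr_half_square one_plus_cmod_square_pos)
qed

text \<open>The logarithmic derivative of a product of two linear powers, with denominators cleared
  so that it also holds at the zeros.\<close>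

lemma poly_pderiv_T_poly:
  assumes "j \<le> k"
  shows "poly (pderiv (T_poly k j l)) z * ((1 + cnj l * z) * (l - z))
     = poly (T_poly k j l) z * (of_nat (k - j) * cnj l * (l - z) - of_nat j * (1 + cnj l * z))"
proof -
  have pw: "of_nat n * x^(n-1) * x = of_nat n * x^n" for n and x :: complex
    by (cases n) auto
  define u v where "u = 1 + cnj l * z" and "v = l - z"
  define c where "c = complex_of_real (sqrt (real (k choose j)) / (1 + (cmod l)^2) powr (real k / 2))"
  have p: "poly (T_poly k j l) z = c * (u^(k-j) * v^j)"
    by (simp add: T_poly_def c_def u_def v_def mult.commute)
  have pd: "poly (pderiv (T_poly k j l)) z
      = c * (u^(k-j) * (of_nat j * v^(j-1) * (-1)) + v^j * (of_nat (k-j) * u^(k-j-1) * cnj l))"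
    by (simp add: T_poly_def c_def u_def v_def pderiv_smult pderiv_mult pderiv_power pderiv_pCons mult_ac)
  have "poly (pderiv (T_poly k j l)) z * (u * v)
      = c * ((of_nat (k-j) * u^(k-j-1) * u) * v^j * cnj l * v - u^(k-j) * (of_nat j * v^(j-1) * v) * u)"
    unfolding pd by (simp add: algebra_simps)
  also have "\<dots> = poly (T_poly k j l) z * (of_nat (k - j) * cnj l * v - of_nat j * u)"
    unfolding pw p by (simp add: algebra_simps)
  finally show ?thesis by (simp add: u_def v_def)
qed

text \<open>The identity is multiplied by the variance k t (1-t) so that it remains meaningful at t
  = 0 and t = 1.\<close>

lemma cmod_inner_T_poly_1_square:
  fixes l z :: complex
  assumes "j \<le> k" "k \<ge> 1"
  defines "t \<equiv> (chordal_dist l z)^2"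
  shows "(cmod (inner_k k (poly (T_poly k 1 z)) (poly (T_poly k j l))))^2 * (real k * (t * (1 - t)))
    = Bernstein k j t * (real j - real k * t)^2"
proof -
  define u v where "u = 1 + cnj l * z" and "v = l - z"
  define S where "S = (1 + (cmod l)^2) * (1 + (cmod z)^2)"
  define N where "N = (1 + (cmod z)^2) powr (real k / 2)"
  define P where "P = poly (T_poly k j l) z"
  define I where "I = inner_k k (poly (T_poly k j l)) (poly (T_poly k 1 z))"
  have S: "S > 0" unfolding S_def by (intro mult_pos_pos one_plus_cmod_square_pos)
  have k0: "of_nat k \<noteq> (0::complex)" using assms(2) by simp
  have uu: "u * cnj u = complex_of_real ((1 - t) * S)"
    unfolding complex_norm_square[symmetric] u_def t_def S_def chordal_dist_square_compl ..
  have vv: "v * cnj v = complex_of_real (t * S)"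
    unfolding complex_norm_square[symmetric] v_def t_def S_def chordal_dist_square ..
  have I: "I = complex_of_real (sqrt (real k) / N) * (cnj z * P - (1 + z * cnj z) * poly (pderiv (T_poly k j l)) z / of_nat k)"
    unfolding I_def P_def N_def by (rule inner_k_T_poly_1[OF degree_T_poly[OF assms(1)] assms(2)])
  have "u * v * (cnj z * P - (1 + z * cnj z) * poly (pderiv (T_poly k j l)) z / of_nat k)
     = u * v * cnj z * P - (1 + z * cnj z) * (poly (pderiv (T_poly k j l)) z * (u * v)) / of_nat k"
    by (simp add: algebra_simps)
  also have "poly (pderiv (T_poly k j l)) z * (u * v) = P * (of_nat (k - j) * cnj l * v - of_nat j * u)"
    unfolding u_def v_def P_def by (rule poly_pderiv_T_poly[OF assms(1)])
  also have "u * v * cnj z * P - (1 + z * cnj z) * (P * (of_nat (k - j) * cnj l * v - of_nat j * u)) / of_nat k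
     = P / of_nat k * (of_nat k * cnj z * u * v - (1 + z * cnj z) * (of_nat (k - j) * cnj l * v - of_nat j * u))"
    using k0 by (simp add: right_diff_distrib diff_divide_distrib mult_ac)
  \<comment> \<open>Here (1 + |z|^2) cnj l = cnj v + cnj z * u and 1 + |z|^2 = cnj u - cnj z * v.
    After substitution the terms in cnj z * u * v cancel, since k - (k-j) - j = 0.\<close>
  also have "of_nat k * cnj z * u * v - (1 + z * cnj z) * (of_nat (k - j) * cnj l * v - of_nat j * u)
     = of_nat j * (u * cnj u) - of_nat (k - j) * (v * cnj v)"
    using assms(1) by (simp add: u_def v_def of_nat_diff algebra_simps)
  also have "\<dots> = complex_of_real (S * (real j - real k * t))"
    unfolding uu vv using assms(1) by (simp add: of_nat_diff algebra_simps)
  finally have uvI: "u * v * I = complex_of_real (sqrt (real k) / N) * (P / of_nat k * complex_of_real (S * (real j - real k * t)))"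
    unfolding I by (simp only: mult.left_commute[of "u * v"])
  have P2: "(cmod P)^2 = Bernstein k j t * N^2"
    unfolding P_def t_def N_def cmod_poly_T_poly_square[OF assms(1)] powr_half_square[OF one_plus_cmod_square_pos] ..
  have N: "N > 0" unfolding N_def using one_plus_cmod_square_pos[of z] by simp
  have "(cmod u)^2 * (cmod v)^2 * (cmod I)^2 = (cmod (u * v * I))^2"
    by (simp add: norm_mult power_mult_distrib)
  also have "\<dots> = (real k / N^2) * ((cmod P)^2 / real k^2 * (S * (real j - real k * t))^2)"
    unfolding uvI norm_mult norm_divide norm_of_real norm_of_nat power_mult_distrib power_divide
    using N by (simp add: power_mult_distrib power_divide)
  also have "\<dots> = Bernstein k j t * (S * (real j - real k * t))^2 / real k"
    unfolding P2 using N assms(2) by (simp add: power2_eq_square)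
  also have "(cmod u)^2 = (1 - t) * S" unfolding u_def t_def S_def chordal_dist_square_compl ..
  also have "(cmod v)^2 = t * S" unfolding v_def t_def S_def chordal_dist_square ..
  finally have "real k * ((1 - t) * S * (t * S) * (cmod I)^2) = Bernstein k j t * (S * (real j - real k * t))^2"
    using assms(2) by simp
  then have "S^2 * ((cmod I)^2 * (real k * (t * (1 - t)))) = S^2 * (Bernstein k j t * (real j - real k * t)^2)"
    by (simp only: power_mult_distrib) (simp only: power2_eq_square mult_ac)
  then have "(cmod I)^2 * (real k * (t * (1 - t))) = Bernstein k j t * (real j - real k * t)^2"
    using S by simp
  moreover have "cmod (inner_k k (poly (T_poly k 1 z)) (poly (T_poly k j l))) = cmod I"
    unfolding I_def using assms(1,2) by (subst inner_k_poly_cnj) (simp_all add: degree_T_poly)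
  ultimately show ?thesis by simp
qed

section \<open>Testing the sampling inequality\<close>

text \<open>Both test vectors have norm 1, so one constant C bounds their sampling sums uniformly in
  k and z.\<close>

lemma sampling_T_poly:
  assumes "L2_sampling \<Lambda> m"
  shows "\<exists>C>0. \<forall>k\<ge>1. \<forall>i\<le>1. \<forall>z. (\<Sum>l\<in>\<Lambda> k. \<Sum>j<m k l.
       (cmod (inner_k k (poly (T_poly k i z)) (T_k k l (e_k k j))))^2) \<in> {1/C..C}"
proof -
  obtain C where C: "C > 0" and bounds: "\<And>k p. \<lbrakk>k \<ge> 1; degree p \<le> k\<rbrakk> \<Longrightarrow>
      norm2_k k (poly p) / C
        \<le> (\<Sum>l\<in>\<Lambda> k. \<Sum>j<m k l. (cmod (inner_k k (poly p) (T_k k l (e_k k j))))^2)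
    \<and> (\<Sum>l\<in>\<Lambda> k. \<Sum>j<m k l. (cmod (inner_k k (poly p) (T_k k l (e_k k j))))^2)
        \<le> C * norm2_k k (poly p)"
    using assms unfolding L2_sampling_def by blast
  show ?thesis
  proof (intro exI[of _ C] conjI C allI impI)
    fix k i :: nat and z
    assume k: "k \<ge> 1" and i: "i \<le> 1"
    have "norm2_k k (poly (T_poly k i z)) = 1"
      using i norm2_T_poly_0 norm2_T_poly_1[OF k] by (cases i) auto
    then show "(\<Sum>l\<in>\<Lambda> k. \<Sum>j<m k l. (cmod (inner_k k (poly (T_poly k i z)) (T_k k l (e_k k j))))^2) \<in> {1/C..C}"
      using bounds[OF k degree_T_poly[of i k z]] i k by simp
  qed
qed

lemma cmod_inner_T_k_0_square:
  "(cmod (inner_k k (poly (T_poly k 0 z)) (T_k k l (e_k k j))))^2 = Bernstein k j ((chordal_dist l z)^2)"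
proof (cases "j \<le> k")
  case True
  then show ?thesis by (simp add: inner_k_T_k cmod_inner_T_poly_0_square)
next
  case False
  then show ?thesis by (simp add: T_k_e_k_eq_0 Bernstein_def inner_k_def binomial_eq_0)
qed

lemma multiplicities_eventually_le:
  assumes fin: "\<And>k. k \<ge> 1 \<Longrightarrow> finite (\<Lambda> k)"
    and lim: "(\<lambda>k. real (Sup (m k ` \<Lambda> k)) / real k) \<longlonglongrightarrow> 0"
  shows "\<exists>k0::nat\<ge>1. \<forall>k\<ge>k0. \<forall>l\<in>\<Lambda> k. 2 * m k l \<le> k"
proof -
  have "\<forall>\<^sub>F k in sequentially. real (Sup (m k ` \<Lambda> k)) / real k < 1/2"
    using lim by (rule order_tendstoD) simp
  then obtain k1 where k1: "\<And>k. k \<ge> k1 \<Longrightarrow> real (Sup (m k ` \<Lambda> k)) / real k < 1/2"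
    unfolding eventually_sequentially by blast
  show ?thesis
  proof (intro exI[of _ "max 1 k1"] conjI allI impI ballI)
    fix k l assume k: "max 1 k1 \<le> k" and l: "l \<in> \<Lambda> k"
    \<comment> \<open>Finiteness of the level makes this supremum of naturals a genuine upper
      bound.\<close>
    have "m k l \<le> Sup (m k ` \<Lambda> k)"
      using l fin[of k] k by (intro cSup_upper) auto
    moreover have "real (Sup (m k ` \<Lambda> k)) < real k / 2"
      using k1[of k] k by (simp add: divide_simps)
    ultimately show "2 * m k l \<le> k" by linarith
  qed simp
qed

lemma finite_overlap:
  assumes fin: "\<And>k. k \<ge> 1 \<Longrightarrow> finite (\<Lambda> k)"
    and mult_pos: "\<And>k l. k \<ge> 1 \<Longrightarrow> l \<in> \<Lambda> k \<Longrightarrow> m k l \<ge> 1"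
    and lim: "(\<lambda>k. real (Sup (m k ` \<Lambda> k)) / real k) \<longlonglongrightarrow> 0"
    and samp: "L2_sampling \<Lambda> m"
  shows "\<exists>B. \<forall>k\<ge>1. \<forall>z. (\<Sum>l\<in>\<Lambda> k. indicator (chordal_disc l (sqrt (real (m k l) / real k))) z) \<le> (B::real)"
proof -
  obtain C where C: "C > 0" and s: "\<And>k i z. \<lbrakk>k \<ge> 1; i \<le> 1\<rbrakk> \<Longrightarrow> (\<Sum>l\<in>\<Lambda> k. \<Sum>j<m k l.
       (cmod (inner_k k (poly (T_poly k i z)) (T_k k l (e_k k j))))^2) \<in> {1/C..C}"
    using sampling_T_poly[OF samp] by blast
  obtain k0 :: nat where k0: "k0 \<ge> 1" "\<And>k l. \<lbrakk>k \<ge> k0; l \<in> \<Lambda> k\<rbrakk> \<Longrightarrow> 2 * m k l \<le> k"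
    using multiplicities_eventually_le[OF fin lim] by blast
  \<comment> \<open>For k >= k0 each disc containing z contributes at least 1/40 to a sum bounded by
    C. The finitely many smaller levels are covered by counting their points.\<close>
  have "(\<Sum>l\<in>\<Lambda> k. indicator (chordal_disc l (sqrt (real (m k l) / real k))) z) \<le> 40 * C + (\<Sum>k<k0. real (card (\<Lambda> k)))"
    if k: "k \<ge> 1" for k z
  proof (cases "k < k0")
    case True
    have "(\<Sum>l\<in>\<Lambda> k. indicator (chordal_disc l (sqrt (real (m k l) / real k))) z) \<le> (\<Sum>l\<in>\<Lambda> k. 1::real)"
      by (intro sum_mono) (simp add: indicator_def)
    also have "\<dots> \<le> (\<Sum>k<k0. real (card (\<Lambda> k)))"
      using True member_le_sum[of k "{..<k0}" "\<lambda>k. real (card (\<Lambda> k))"] by simp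
    finally show ?thesis using C by simp
  next
    case False
    have "(\<Sum>l\<in>\<Lambda> k. indicator (chordal_disc l (sqrt (real (m k l) / real k))) z)
       \<le> (\<Sum>l\<in>\<Lambda> k. 40 * (\<Sum>j<m k l. Bernstein k j ((chordal_dist l z)^2)))"
    proof (intro sum_mono)
      fix l assume l: "l \<in> \<Lambda> k"
      show "indicator (chordal_disc l (sqrt (real (m k l) / real k))) z \<le> 40 * (\<Sum>j<m k l. Bernstein k j ((chordal_dist l z)^2))"
      proof (cases "z \<in> chordal_disc l (sqrt (real (m k l) / real k))")
        case True
        have d0: "chordal_dist l z \<ge> 0" by (simp add: chordal_dist_def)
        have "(chordal_dist l z)^2 < (sqrt (real (m k l) / real k))^2"
          using True d0 by (intro power_strict_mono) (auto simp: chordal_disc_def)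
        then have "real k * (chordal_dist l z)^2 < real (m k l)"
          using k by (simp add: field_simps)
        then have "(\<Sum>j<m k l. Bernstein k j ((chordal_dist l z)^2)) \<ge> 1/40"
          using mult_pos[OF k l] k0(2)[of k l] l False by (intro Bernstein_lower_tail) auto
        then show ?thesis by (simp add: indicator_def)
      next
        case False
        then show ?thesis
          by (auto intro!: sum_nonneg Bernstein_nonneg chordal_dist_square_le_1)
      qed
    qed
    also have "\<dots> \<le> 40 * C"
      using s[of k 0 z] k unfolding cmod_inner_T_k_0_square by (simp add: sum_distrib_left[symmetric])
    also have "\<dots> \<le> 40 * C + (\<Sum>k<k0. real (card (\<Lambda> k)))"
      by (simp add: sum_nonneg)
    finally show ?thesis .
  qed
  then show ?thesis by blast
qed

text \<open>In the scaled distance r, with r^2 = k t, the hypothesis reads r >= sqrt n + c. Then k t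
  - j = (r - sqrt j) (r + sqrt j) >= c r, so (j - k t)^2 is at least c^2 times k t, which exceeds
  the variance.\<close>

lemma cmod_inner_T_k_1_square_ge:
  assumes "j < n" "n \<le> k" "c > 0" and d: "chordal_dist l z \<ge> (sqrt (real n) + c) / sqrt (real k)"
  shows "c^2 * (cmod (inner_k k (poly (T_poly k 0 z)) (T_k k l (e_k k j))))^2
     \<le> (cmod (inner_k k (poly (T_poly k 1 z)) (T_k k l (e_k k j))))^2"
proof -
  define t where "t = (chordal_dist l z)^2"
  define I where "I = (cmod (inner_k k (poly (T_poly k 1 z)) (T_k k l (e_k k j))))^2"
  define r where "r = sqrt (real k) * chordal_dist l z"
  have jk: "j < k" "k \<ge> 1" using assms by auto
  have t1: "t \<le> 1" unfolding t_def by (rule chordal_dist_square_le_1)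
  have r2: "r^2 = real k * t" by (simp add: r_def t_def power_mult_distrib)
  have "r \<ge> sqrt (real n) + c"
    using d jk by (simp add: r_def divide_simps mult.commute)
  moreover have "sqrt (real j) \<le> sqrt (real n)" using assms(1) by simp
  ultimately have rj: "r \<ge> sqrt (real j) + c" by linarith
  then have r0: "r > 0" using assms(3) by (smt (verit) real_sqrt_ge_zero of_nat_0_le_iff)
  then have t0: "t > 0" using r2 jk by (metis zero_less_mult_iff zero_less_power of_nat_0_le_iff not_less)
  have I: "I * (real k * (t * (1 - t))) = Bernstein k j t * (real j - real k * t)^2"
    using cmod_inner_T_poly_1_square[of j k z l] jk unfolding I_def t_def by (simp add: inner_k_T_k)
  have B0: "Bernstein k j t \<ge> 0" using t0 t1 by (intro Bernstein_nonneg) auto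
  have "c^2 * Bernstein k j t \<le> I"
  proof (cases "t = 1")
    \<comment> \<open>At antipodal points the variance vanishes and cannot be divided out, but the
      weight of j < k is then 0.\<close>
    case True
    then have "Bernstein k j t = 0" using jk by (simp add: Bernstein_def)
    then show ?thesis by (simp add: I_def)
  next
    case False
    with t1 have t1': "t < 1" by simp
    have "c * r \<le> (r - sqrt (real j)) * (r + sqrt (real j))"
      using rj r0 assms(3) by (intro mult_mono) auto
    also have "\<dots> = real k * t - real j"
      unfolding r2[symmetric] by (simp add: algebra_simps power2_eq_square)
    finally have "(c * r)^2 \<le> (real k * t - real j)^2"
      using assms(3) r0 by (intro power_mono) auto
    then have le: "c^2 * (real k * t) \<le> (real j - real k * t)^2"
      by (simp add: power_mult_distrib r2 power2_commute)
    have "c^2 * (real k * (t * (1 - t))) \<le> c^2 * (real k * (t * 1))"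
      using t0 by (intro mult_left_mono) auto
    also have "\<dots> \<le> (real j - real k * t)^2" using le by simp
    finally have "Bernstein k j t * (c^2 * (real k * (t * (1 - t)))) \<le> I * (real k * (t * (1 - t)))"
      unfolding I using B0 by (rule mult_left_mono)
    then have "(c^2 * Bernstein k j t) * (real k * (t * (1 - t))) \<le> I * (real k * (t * (1 - t)))"
      by (simp only: mult.left_commute[of "c^2"] mult.assoc)
    moreover have "real k * (t * (1 - t)) > 0" using t0 t1' jk by simp
    ultimately show ?thesis
      by (rule mult_right_le_imp_le)
  qed
  then show ?thesis unfolding cmod_inner_T_k_0_square I_def t_def .
qed

lemma covering:
  assumes fin: "\<And>k. k \<ge> 1 \<Longrightarrow> finite (\<Lambda> k)"
    and lim: "(\<lambda>k. real (Sup (m k ` \<Lambda> k)) / real k) \<longlonglongrightarrow> 0"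
    and samp: "L2_sampling \<Lambda> m"
  shows "\<exists>c>0. \<exists>k0::nat. \<forall>k\<ge>k0.
    (\<Union>l\<in>\<Lambda> k. chordal_disc l ((sqrt (real (m k l)) + c) / sqrt (real k))) = UNIV"
proof -
  obtain C where C: "C > 0" and s: "\<And>k i z. \<lbrakk>k \<ge> 1; i \<le> 1\<rbrakk> \<Longrightarrow> (\<Sum>l\<in>\<Lambda> k. \<Sum>j<m k l.
       (cmod (inner_k k (poly (T_poly k i z)) (T_k k l (e_k k j))))^2) \<in> {1/C..C}"
    using sampling_T_poly[OF samp] by blast
  obtain k0 :: nat where k0: "k0 \<ge> 1" "\<And>k l. \<lbrakk>k \<ge> k0; l \<in> \<Lambda> k\<rbrakk> \<Longrightarrow> 2 * m k l \<le> k"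
    using multiplicities_eventually_le[OF fin lim] by blast
  \<comment> \<open>The choice c = C + 1 exceeds C: an uncovered z would force (C+1)^2 / C <=
    C.\<close>
  have "z \<in> (\<Union>l\<in>\<Lambda> k. chordal_disc l ((sqrt (real (m k l)) + (C + 1)) / sqrt (real k)))" if k: "k \<ge> k0" for k z
  proof (rule ccontr)
    assume "\<not> ?thesis"
    then have far: "chordal_dist l z \<ge> (sqrt (real (m k l)) + (C + 1)) / sqrt (real k)" if "l \<in> \<Lambda> k" for l
      using that by (auto simp: chordal_disc_def not_less)
    define S where "S i = (\<Sum>l\<in>\<Lambda> k. \<Sum>j<m k l. (cmod (inner_k k (poly (T_poly k i z)) (T_k k l (e_k k j))))^2)" for i
    have "(C + 1)^2 * S 0 \<le> S 1"
      unfolding S_def sum_distrib_left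
    proof (intro sum_mono cmod_inner_T_k_1_square_ge)
      fix l j assume "l \<in> \<Lambda> k" "j \<in> {..<m k l}"
      then show "j < m k l" "m k l \<le> k" "C + 1 > 0" "chordal_dist l z \<ge> (sqrt (real (m k l)) + (C + 1)) / sqrt (real k)"
        using k0(2)[OF k] far C by fastforce+
    qed
    moreover have "S 1 \<le> C" "S 0 \<ge> 1/C"
      using s[of k 1 z] s[of k 0 z] k k0(1) by (auto simp: S_def)
    moreover have "(C + 1)^2 * (1/C) \<le> (C + 1)^2 * S 0"
      using \<open>S 0 \<ge> 1/C\<close> by (intro mult_left_mono) auto
    ultimately have "(C + 1)^2 * (1/C) \<le> C" by linarith
    then have "(C + 1)^2 \<le> C^2" using C by (simp add: divide_simps power2_eq_square)
    then show False using C by (simp add: power2_eq_square algebra_simps)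
  qed
  then show ?thesis using C by (intro exI[of _ "C+1"] conjI exI[of _ k0]) auto
qed

theorem theorem1p2:
  fixes \<Lambda> :: "nat \<Rightarrow> complex set" and m :: "nat \<Rightarrow> complex \<Rightarrow> nat"
  assumes fin: "\<And>k. k \<ge> 1 \<Longrightarrow> finite (\<Lambda> k)"
    and mult_pos: "\<And>k l. k \<ge> 1 \<Longrightarrow> l \<in> \<Lambda> k \<Longrightarrow> m k l \<ge> 1"
    and lim: "(\<lambda>k. real (Sup (m k ` \<Lambda> k)) / real k) \<longlonglongrightarrow> 0"
    and samp: "L2_sampling \<Lambda> m"
  shows "(\<exists>B. \<forall>k\<ge>1. \<forall>z. (\<Sum>l\<in>\<Lambda> k. indicator (chordal_disc l (sqrt (real (m k l) / real k))) z) \<le> (B::real))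
       \<and> (\<exists>c>0. \<exists>k0::nat. \<forall>k\<ge>k0.
            (\<Union>l\<in>\<Lambda> k. chordal_disc l ((sqrt (real (m k l)) + c) / sqrt (real k))) = UNIV)"
  using finite_overlap[OF fin mult_pos lim samp] covering[OF fin lim samp] by blast

end
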